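(* Let $w>0$ be a real number and let $\sigma$ be a real number with $\sigma>0$ and $\sigma\neq 1$. Then the Hurwitz zeta function satisfies $$\zeta(\sigma,w)<\frac{1-\sigma-w}{(1-\sigma)\,w^{\sigma}}.$$
   Context: For a real number $w>0$, the Hurwitz zeta function is defined for $\Re(s)>1$ by $\zeta(s,w)=\sum_{n=0}^{\infty}(n+w)^{-s}$, and is extended by analytic continuation to a meromorphic function of $s\in\mathbb{C}$ whose only pole is a simple pole at $s=1$. Here $\zeta(\sigma,w)$ denotes the value of this continuation at the real point $s=\sigma$. *)

theory Defs
  imports "HOL-Complex_Analysis.Complex_Analysis"
begin

definition hurwitz_continuation :: "real \<Rightarrow> (complex \<Rightarrow> complex) \<Rightarrow> bool" where
  "hurwitz_continuation w f \<longleftrightarrow>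
     f holomorphic_on (- {1}) \<and>
     (\<forall>s. Re s > 1 \<longrightarrow> (\<lambda>n. complex_of_real (real n + w) powr (- s)) sums f s)"

text \<open>For w > 0 the conditions above determine f on the whole plane except at its pole 1
  (lemma \<open>hurwitz_continuation_unique\<close>). The value at 1 is unspecified.\<close>

definition hurwitz_zeta :: "complex \<Rightarrow> real \<Rightarrow> complex" where
  "hurwitz_zeta s w = (SOME f. hurwitz_continuation w f) s"

lemma hurwitz_continuation_unique:
  assumes f: "hurwitz_continuation w f" and g: "hurwitz_continuation w g" and "s \<noteq> 1"
  shows "f s = g s"
proof (rule analytic_continuation_open[of "{z. Re z > 1}" "- {1}" f g])
  show "open {z. Re z > 1}"
    by (rule open_halfspace_Re_gt)
  show "{z. Re z > 1} \<noteq> {}"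
    by (auto intro!: exI[of _ 2])
  show "connected (- {1 :: complex})"
    by (rule connected_punctured_universe) simp
  show "f z = g z" if "z \<in> {z. Re z > 1}" for z
    using f g that unfolding hurwitz_continuation_def by (auto intro: sums_unique2)
qed (use assms in \<open>auto simp: hurwitz_continuation_def\<close>)

end

theory Submission
  imports Defs
begin

text \<open>For \<open>p\<close> continuous on \<open>[0,1]\<close> let \<open>z(p,s)\<close> be the integral over \<open>[w,\<infinity>)\<close> of
  \<open>x powr (-s)\<close> against the 1-periodic extension of \<open>p\<close>. With \<open>c\<close> the mean of \<open>p\<close> and \<open>P\<close> the
  primitive of \<open>p - c\<close> vanishing at 0, hence also at 1, integration by parts has no boundary terms
  and gives \<open>(s-1) z(p,s) = c w powr (1-s) + (s-1) s z(P,s+1)\<close>. As this holds for all \<open>p\<close>,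
  iterating it continues \<open>(s-1) z(p,s)\<close> to an entire function. One more integration by parts gives
  \<open>\<zeta>(s,w) = w powr (1-s) / (s-1) + s z(1-t,s+1)\<close>. At a real point \<open>\<sigma> > 0\<close> the last integral
  converges, and it is strictly smaller than \<open>z(1,\<sigma>+1) = w powr (-\<sigma>) / \<sigma>\<close>.\<close>

section \<open>Integrals over one cell and integration by parts\<close>

text \<open>The part of the integral \<open>z(p,s)\<close> that comes from
  \<open>[x, x + 1]\<close>: summing over \<open>x = n + w\<close> gives \<open>z(p,s)\<close>. Only
  the values of \<open>p\<close> on one period enter.\<close>

definition powr_cell :: "(real \<Rightarrow> complex) \<Rightarrow> complex \<Rightarrow> real \<Rightarrow> complex" where
  "powr_cell p s x = integral {0..1} (\<lambda>t. p t * complex_of_real (x + t) powr (- s))"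

text \<open>The exponential form makes continuity in the base and holomorphy in \<open>s\<close>
  immediate.\<close>

lemma of_real_powr_eq_exp:
  assumes "y > 0"
  shows "complex_of_real y powr (- s) = exp (- s * complex_of_real (ln y))"
  using assms by (simp add: powr_def Ln_of_real)

lemma continuous_on_powr_cell:
  assumes "x > 0" "continuous_on {0..1} p"
  shows "continuous_on {0..1} (\<lambda>t. p t * complex_of_real (x + t) powr (- s))"
proof -
  have "continuous_on {0..1} (\<lambda>t. p t * exp (- s * complex_of_real (ln (x + t))))"
    using assms by (intro continuous_intros) auto
  also have "?this \<longleftrightarrow> ?thesis"
    using assms by (intro continuous_on_cong) (auto simp: of_real_powr_eq_exp simp del: of_real_add)
  finally show ?thesis .
qed

lemma integrable_powr_cell:
  assumes "x > 0" "continuous_on {0..1} p"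
  shows "(\<lambda>t. p t * complex_of_real (x + t) powr (- s)) integrable_on {0..1}"
  using continuous_on_powr_cell[OF assms] by (rule integrable_continuous_real)

lemma powr_cell_diff_const:
  assumes "x > 0" "continuous_on {0..1} p"
  shows "powr_cell (\<lambda>t. p t - c) s x = powr_cell p s x - c * powr_cell (\<lambda>_. 1) s x"
proof -
  have "(\<lambda>t. c * complex_of_real (x + t) powr (- s)) integrable_on {0..1}"
    using assms by (intro integrable_powr_cell) auto
  then show ?thesis
    using integrable_powr_cell[OF assms]
    unfolding powr_cell_def by (simp add: left_diff_distrib integral_diff)
qed

text \<open>Fundamental theorem of calculus for \<open>P t * (x + t) powr (- s)\<close>. The
  boundary terms stay, because the applications differ in them: \<open>P = 1\<close> keeps both,
  \<open>P = 1 - t\<close> keeps the left one, and the normalized primitive keeps none.\<close>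

lemma powr_cell_by_parts:
  assumes x: "x > 0" and p: "continuous_on {0..1} p"
    and P: "\<And>t. t \<in> {0..1} \<Longrightarrow> (P has_vector_derivative p t) (at t within {0..1})"
  shows "P 1 * complex_of_real (x + 1) powr (- s) - P 0 * complex_of_real x powr (- s) =
         powr_cell p s x - s * powr_cell P (s + 1) x"
proof -
  have contP: "continuous_on {0..1} P"
    using P by (rule continuous_on_vector_derivative)
  let ?F = "\<lambda>t. P t * complex_of_real (x + t) powr (- s)"
  let ?f = "\<lambda>t. p t * complex_of_real (x + t) powr (- s)"
  let ?g = "\<lambda>t. P t * complex_of_real (x + t) powr (- (s + 1))"
  have deriv: "(?F has_vector_derivative ?f t - s * ?g t) (at t within {0..1})" if "t \<in> {0..1}" for t
  proof -
    have "((\<lambda>z. z powr (- s)) has_field_derivative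
            (- s * complex_of_real (x + t) powr (- (s + 1)))) (at (complex_of_real (x + t)))"
      using x that has_field_derivative_powr[of "complex_of_real (x + t)" "- s"]
      by (simp add: complex_nonpos_Reals_iff)
    moreover have "((\<lambda>t. complex_of_real (x + t)) has_vector_derivative 1) (at t within {0..1})"
      by (auto intro!: derivative_eq_intros)
    ultimately have "((\<lambda>t. complex_of_real (x + t) powr (- s)) has_vector_derivative
            (1 * (- s * complex_of_real (x + t) powr (- (s + 1))))) (at t within {0..1})"
      using field_vector_diff_chain_within[unfolded o_def] has_field_derivative_at_within by blast
    from has_vector_derivative_mult[OF P[OF that] this] show ?thesis
      by (simp add: algebra_simps)
  qed
  have "((\<lambda>t. ?f t - s * ?g t) has_integral (?F 1 - ?F 0)) {0..1}"
    by (rule fundamental_theorem_of_calculus) (use deriv in auto)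
  moreover have "((\<lambda>t. ?f t - s * ?g t) has_integral
      (powr_cell p s x - s * powr_cell P (s + 1) x)) {0..1}"
    unfolding powr_cell_def
    by (intro has_integral_diff has_integral_mult_right integrable_integral
        integrable_powr_cell x p contP)
  ultimately have "?F 1 - ?F 0 = powr_cell p s x - s * powr_cell P (s + 1) x"
    by (rule has_integral_unique)
  then show ?thesis by simp
qed

text \<open>Integration by parts with \<open>P = 1\<close>, \<open>p = 0\<close> and exponent
  \<open>s - 1\<close>. The right-hand side telescopes along \<open>x = n + w\<close>.\<close>

lemma powr_cell_one:
  assumes "x > 0"
  shows "(s - 1) * powr_cell (\<lambda>_. 1) s x =
         complex_of_real x powr (1 - s) - complex_of_real (x + 1) powr (1 - s)"
proof -
  have "powr_cell (\<lambda>_. 0) (s - 1) x = 0"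
    by (simp add: powr_cell_def)
  with powr_cell_by_parts[OF assms, of "\<lambda>_. 0" "\<lambda>_. 1" "s - 1"] show ?thesis
    by (simp add: algebra_simps)
qed

text \<open>The weight \<open>1 - t\<close> is 1 at the left end and 0 at the right end, so the
  boundary terms isolate one term of the Hurwitz series.\<close>

lemma powr_eq_powr_cell:
  assumes "x > 0"
  shows "complex_of_real x powr (- s) =
         powr_cell (\<lambda>_. 1) s x + s * powr_cell (\<lambda>t. complex_of_real (1 - t)) (s + 1) x"
proof -
  have d: "((\<lambda>t. complex_of_real (1 - t)) has_vector_derivative -1) (at t within {0..1})" for t
    by (auto intro!: derivative_eq_intros)
  have "powr_cell (\<lambda>_. -1) s x = - powr_cell (\<lambda>_. 1) s x"
    by (simp add: powr_cell_def)
  with powr_cell_by_parts[OF assms _ d, of s] show ?thesis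
    by (simp add: algebra_simps)
qed

text \<open>Removing the mean makes the primitive vanish at both ends. The remaining cell has
  exponent \<open>s + 1\<close>, so its series converges one unit further to the left; this is the
  step that gets iterated.\<close>

lemma powr_cell_eq_diff_const_primitive:
  assumes x: "x > 0" and p: "continuous_on {0..1} p"
  defines "c \<equiv> integral {0..1} p"
  defines "P \<equiv> (\<lambda>t. integral {0..t} (\<lambda>u. p u - c))"
  shows "powr_cell p s x = c * powr_cell (\<lambda>_. 1) s x + s * powr_cell P (s + 1) x"
proof -
  have pc: "continuous_on {0..1} (\<lambda>u. p u - c)"
    using p by (intro continuous_intros)
  have d: "(P has_vector_derivative p t - c) (at t within {0..1})" if "t \<in> {0..1}" for t
    unfolding P_def using integral_has_vector_derivative[OF pc that] .
  have "P 1 = 0" "P 0 = 0"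
    using integral_diff[OF integrable_continuous_real[OF p] integrable_const_ivl, of c]
    by (simp_all add: P_def c_def)
  with powr_cell_by_parts[OF x pc d, of s] powr_cell_diff_const[OF x p, of c s] show ?thesis
    by (simp add: algebra_simps)
qed

section \<open>Holomorphy and convergence of the cell series\<close>

lemma holomorphic_powr_cell:
  assumes "x > 0" "continuous_on {0..1} p"
  shows "(\<lambda>s. powr_cell p s x) holomorphic_on UNIV"
proof -
  let ?f = "\<lambda>s t. p t * exp (- s * complex_of_real (ln (x + t)))"
  have *: "?f s t = p t * complex_of_real (x + t) powr (- s)" if "t \<in> {0..1}" for s t
    using that assms by (simp add: of_real_powr_eq_exp del: of_real_add)
  have "(\<lambda>s. integral (cbox 0 1) (?f s)) holomorphic_on UNIV"
  proof (rule leibniz_rule_holomorphic[where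
        fx = "\<lambda>s t. - complex_of_real (ln (x + t)) * p t * exp (- s * complex_of_real (ln (x + t)))"])
    show "?f s integrable_on cbox 0 1" for s
      using assms by (intro integrable_continuous continuous_intros) auto
    have "continuous_on (UNIV \<times> {0..1}) (\<lambda>z::complex \<times> real. p (snd z))"
      by (rule continuous_on_compose2[OF assms(2)]) (auto intro!: continuous_intros)
    then show "continuous_on (UNIV \<times> cbox 0 1) (\<lambda>(s, t).
        - complex_of_real (ln (x + t)) * p t * exp (- s * complex_of_real (ln (x + t))))"
      using assms unfolding case_prod_unfold by (intro continuous_intros) auto
  qed (auto intro!: derivative_eq_intros)
  also have "(\<lambda>s. integral (cbox 0 1) (?f s)) = (\<lambda>s. powr_cell p s x)"
    unfolding powr_cell_def box_real by (rule ext, rule integral_cong, rule *)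
  finally show ?thesis .
qed

text \<open>A majorant uniform in \<open>s\<close>. Lowering the base to \<open>real n\<close>,
  which is at least 1, allows the exponent \<open>- Re s\<close> to be raised to \<open>- a\<close>;
  the base \<open>real n + w\<close> could be below 1 for \<open>n = 0\<close>.\<close>

lemma norm_powr_cell_le:
  assumes n: "n > 0" and w: "w > 0" and a: "a \<le> Re s" "a > 0"
    and p: "continuous_on {0..1} p" "\<And>t. t \<in> {0..1} \<Longrightarrow> norm (p t) \<le> B"
  shows "norm (powr_cell p s (real n + w)) \<le> B * real n powr (- a)"
proof -
  have "norm (powr_cell p s (real n + w)) \<le> (B * real n powr (- a)) * (1 - 0)"
    unfolding powr_cell_def
  proof (rule integral_bound)
    show "continuous_on {0..1} (\<lambda>t. p t * complex_of_real (real n + w + t) powr - s)"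
      using n w p by (intro continuous_on_powr_cell) auto
    fix t :: real assume t: "t \<in> {0..1}"
    have "norm (complex_of_real (real n + w + t) powr (- s)) = (real n + w + t) powr (- Re s)"
      using t w by (subst norm_powr_real_powr) auto
    also have "\<dots> \<le> real n powr (- Re s)"
      using t w n a by (intro powr_mono2') auto
    also have "\<dots> \<le> real n powr (- a)"
      using n a by (intro powr_mono) auto
    finally show "norm (p t * complex_of_real (real n + w + t) powr - s) \<le> B * real n powr - a"
      using p(2)[OF t] by (auto simp: norm_mult intro!: mult_mono order_trans[OF norm_ge_zero])
  qed auto
  then show ?thesis by simp
qed

lemma continuous_on_unit_interval_bounded:
  fixes p :: "real \<Rightarrow> complex"
  assumes "continuous_on {0..1} p"
  obtains B where "\<And>t. t \<in> {0..1} \<Longrightarrow> norm (p t) \<le> B"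
proof -
  have "bounded (p ` {0..1})"
    using assms by (intro compact_imp_bounded compact_continuous_image) auto
  then show ?thesis
    using that unfolding bounded_iff by blast
qed

lemma uniform_limit_powr_cell_series:
  assumes w: "w > 0" and p: "continuous_on {0..1} p" and a: "a > 1" "\<And>s. s \<in> A \<Longrightarrow> a \<le> Re s"
  shows "uniform_limit A (\<lambda>n s. \<Sum>k<n. powr_cell p s (real k + w))
           (\<lambda>s. \<Sum>k. powr_cell p s (real k + w)) sequentially"
proof -
  obtain B where B: "\<And>t. t \<in> {0..1} \<Longrightarrow> norm (p t) \<le> B"
    using continuous_on_unit_interval_bounded[OF p] by blast
  show ?thesis
  proof (rule Weierstrass_m_test_ev)
    \<comment> \<open>The majorant holds from \<open>n = 1\<close> on, hence the eventual form of
      the test.\<close>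
    show "\<forall>\<^sub>F n in sequentially. \<forall>s\<in>A. norm (powr_cell p s (real n + w)) \<le> B * real n powr (- a)"
      using eventually_gt_at_top[of 0]
    proof eventually_elim
      case (elim n)
      with w a p B show ?case by (auto intro!: norm_powr_cell_le)
    qed
    show "summable (\<lambda>n. B * real n powr (- a))"
      using a by (intro summable_mult) (auto simp: summable_real_powr_iff)
  qed
qed

lemma sums_powr_cell:
  assumes "w > 0" "continuous_on {0..1} p" "Re s > 1"
  shows "(\<lambda>n. powr_cell p s (real n + w)) sums (\<Sum>n. powr_cell p s (real n + w))"
  using tendsto_uniform_limitI[OF uniform_limit_powr_cell_series[OF assms(1,2), of "Re s" "{s}"]]
    assms(3) by (simp add: sums_def)

lemma holomorphic_powr_cell_series:
  assumes w: "w > 0" and p: "continuous_on {0..1} p"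
  shows "(\<lambda>s. \<Sum>n. powr_cell p s (real n + w)) holomorphic_on {s. Re s > 1}"
proof (rule holomorphic_uniform_sequence)
  show "(\<lambda>s. \<Sum>k<n. powr_cell p s (real k + w)) holomorphic_on {s. Re s > 1}" for n
    using w by (intro holomorphic_intros holomorphic_on_subset[OF holomorphic_powr_cell] p) auto
  fix z assume z: "z \<in> {s. Re s > 1}"
  \<comment> \<open>Half the distance from \<open>z\<close> to the line \<open>Re s = 1\<close>, so
    the closed disc stays in a half-plane \<open>Re s \<ge> a\<close> with
    \<open>a > 1\<close>.\<close>
  define d where "d = (Re z - 1) / 2"
  have d: "d > 0" "Re z - d > 1"
    using z by (auto simp: d_def field_simps)
  have re: "Re z - d \<le> Re s" if "s \<in> cball z d" for s
    using that abs_Re_le_cmod[of "z - s"] by (auto simp: dist_norm)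
  have "cball z d \<subseteq> {s. Re s > 1}"
    using re d by force
  with uniform_limit_powr_cell_series[OF w p d(2) re] d(1)
  show "\<exists>d. 0 < d \<and> cball z d \<subseteq> {s. Re s > 1} \<and>
      uniform_limit (cball z d) (\<lambda>n s. \<Sum>k<n. powr_cell p s (real k + w))
        (\<lambda>s. \<Sum>n. powr_cell p s (real n + w)) sequentially"
    by blast
qed (rule open_halfspace_Re_gt)

lemma sums_powr_cell_one:
  assumes w: "w > 0" and s: "Re s > 1"
  shows "(\<lambda>n. powr_cell (\<lambda>_. 1) s (real n + w)) sums (complex_of_real w powr (1 - s) / (s - 1))"
proof -
  have "filterlim (\<lambda>n. real n + w) at_top sequentially"
    using filterlim_tendsto_add_at_top[OF tendsto_const filterlim_real_sequentially]
    by (simp add: add.commute)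
  then have "(\<lambda>n. (real n + w) powr (1 - Re s)) \<longlonglongrightarrow> 0"
    using s by (intro tendsto_neg_powr) auto
  moreover have "norm (complex_of_real (real n + w) powr (1 - s)) = (real n + w) powr (1 - Re s)" for n
    using w by (subst norm_powr_real_powr) auto
  ultimately have "(\<lambda>n. complex_of_real (real n + w) powr (1 - s)) \<longlonglongrightarrow> 0"
    using tendsto_norm_zero_iff by (metis (no_types, lifting) ext)
  from sums_divide[OF telescope_sums'[OF this], of "s - 1"]
  have "(\<lambda>n. (complex_of_real (real n + w) powr (1 - s) -
        complex_of_real (real n + w + 1) powr (1 - s)) / (s - 1))
      sums (complex_of_real w powr (1 - s) / (s - 1))"
    by (simp add: add_ac)
  moreover have "(complex_of_real (real n + w) powr (1 - s) -
        complex_of_real (real n + w + 1) powr (1 - s)) / (s - 1)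
      = powr_cell (\<lambda>_. 1) s (real n + w)" for n
  proof -
    have "s \<noteq> 1" using s by auto
    moreover have "real n + w > 0" using w by auto
    ultimately show ?thesis
      using powr_cell_one[of "real n + w" s] by (simp add: field_simps)
  qed
  ultimately show ?thesis by simp
qed

section \<open>Analytic continuation of the cell series\<close>

text \<open>Each integration by parts gains a strip of width 1. It replaces \<open>p\<close> by
  \<open>P\<close>, so the induction must cover all weights; the factor \<open>s - 1\<close> cancels
  the pole coming from the mean.\<close>

lemma powr_cell_series_continuation_halfplane:
  assumes w: "w > 0" and p: "continuous_on {0..1} p"
  shows "\<exists>h. h holomorphic_on {s. Re s > 1 - real k} \<and>
    (\<forall>s. Re s > 1 \<longrightarrow> h s = (s - 1) * (\<Sum>n. powr_cell p s (real n + w)))"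
  using p
proof (induction k arbitrary: p)
  case 0
  let ?h = "\<lambda>s. (s - 1) * (\<Sum>n. powr_cell p s (real n + w))"
  have "?h holomorphic_on {s. Re s > 1}"
    by (intro holomorphic_on_mult holomorphic_on_diff holomorphic_on_ident holomorphic_on_const
        holomorphic_powr_cell_series w 0)
  then show ?case
    by (intro exI[of _ ?h]) simp
next
  case (Suc k)
  define c where "c = integral {0..1} p"
  define P where "P = (\<lambda>t. integral {0..t} (\<lambda>u. p u - c))"
  have "continuous_on {0..1} (\<lambda>u. p u - c)"
    using Suc.prems by (intro continuous_intros)
  then have P: "continuous_on {0..1} P"
    unfolding P_def by (intro indefinite_integral_continuous_1 integrable_continuous_real)
  obtain h where h: "h holomorphic_on {s. Re s > 1 - real k}"
    "\<And>s. Re s > 1 \<Longrightarrow> h s = (s - 1) * (\<Sum>n. powr_cell P s (real n + w))"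
    using Suc.IH[OF P] by blast
  \<comment> \<open>The factor \<open>s\<close> in front of the series for \<open>P\<close> is
    hidden in \<open>h (s + 1)\<close>, since \<open>(s + 1) - 1 = s\<close>.\<close>
  let ?h = "\<lambda>s. c * complex_of_real w powr (1 - s) + (s - 1) * h (s + 1)"
  have "(h \<circ> (\<lambda>s. s + 1)) holomorphic_on {s. Re s > 1 - real (Suc k)}"
    by (rule holomorphic_on_compose_gen[OF _ h(1)]) (auto intro!: holomorphic_intros)
  then have "?h holomorphic_on {s. Re s > 1 - real (Suc k)}"
    unfolding o_def by (intro holomorphic_intros) (use w in auto)
  moreover have "?h s = (s - 1) * (\<Sum>n. powr_cell p s (real n + w))" if s: "Re s > 1" for s
  proof -
    have "s \<noteq> 1" using s by auto
    have "(\<lambda>n. c * powr_cell (\<lambda>_. 1) s (real n + w) + s * powr_cell P (s + 1) (real n + w)) sums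
        (c * (complex_of_real w powr (1 - s) / (s - 1)) +
         s * (\<Sum>n. powr_cell P (s + 1) (real n + w)))"
      using s by (intro sums_add sums_mult sums_powr_cell_one sums_powr_cell w P) auto
    also have "(\<lambda>n. c * powr_cell (\<lambda>_. 1) s (real n + w) + s * powr_cell P (s + 1) (real n + w)) =
        (\<lambda>n. powr_cell p s (real n + w))"
      unfolding c_def P_def
      by (intro ext powr_cell_eq_diff_const_primitive[symmetric] Suc.prems) (use w in auto)
    finally have "(\<Sum>n. powr_cell p s (real n + w)) = c * (complex_of_real w powr (1 - s) / (s - 1)) +
         s * (\<Sum>n. powr_cell P (s + 1) (real n + w))"
      by (rule sums_unique[symmetric])
    with \<open>s \<noteq> 1\<close> h(2)[of "s + 1"] s show ?thesis
      by (simp add: field_simps)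
  qed
  ultimately show ?case by blast
qed

lemma powr_cell_series_continuation:
  assumes w: "w > 0" and p: "continuous_on {0..1} p"
  obtains h where "h holomorphic_on UNIV"
    "\<And>s. Re s > 1 \<Longrightarrow> h s = (s - 1) * (\<Sum>n. powr_cell p s (real n + w))"
proof -
  obtain H where H: "\<And>k. H k holomorphic_on {s. Re s > 1 - real k}"
    "\<And>k s. Re s > 1 \<Longrightarrow> H k s = (s - 1) * (\<Sum>n. powr_cell p s (real n + w))"
    using powr_cell_series_continuation_halfplane[OF w p] by metis
  \<comment> \<open>With \<open>k \<ge> 2 - Re s\<close> the point \<open>s\<close> lies in the
    half-plane of \<open>H k\<close>.\<close>
  define h where "h s = H (nat \<lceil>2 - Re s\<rceil>) s" for s
  \<comment> \<open>All \<open>H k\<close> agree for \<open>Re s > 1\<close>, so the identity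
    theorem glues them on the smaller of two half-planes.\<close>
  have mono: "H k s = H l s" if "k \<le> l" "Re s > 1 - real k" for k l s
  proof (rule analytic_continuation_open[of "{z. Re z > 1}" "{z. Re z > 1 - real k}" "H k" "H l"])
    show "{z. Re z > 1} \<noteq> {}"
      by (auto intro!: exI[of _ 2])
    show "connected {z. Re z > 1 - real k}"
      by (intro convex_connected convex_halfspace_Re_gt)
    show "H l holomorphic_on {z. Re z > 1 - real k}"
      by (rule holomorphic_on_subset[OF H(1)]) (use that in auto)
  qed (use H that in \<open>auto simp: open_halfspace_Re_gt\<close>)
  have h_eq: "h s = H k s" if "Re s > 1 - real k" for k s
  proof -
    have "Re s > 1 - real (nat \<lceil>2 - Re s\<rceil>)" by linarith
    with mono that show ?thesis
      unfolding h_def by (metis linear)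
  qed
  have "h holomorphic_on (\<Union>k. {s. Re s > 1 - real k})"
  proof (rule holomorphic_on_UN_open)
    show "h holomorphic_on {s. Re s > 1 - real k}" for k
      using H(1)[of k] by (rule holomorphic_transform) (use h_eq in auto)
  qed (rule open_halfspace_Re_gt)
  moreover have "(\<Union>k. {s. Re s > 1 - real k}) = UNIV"
  proof (intro equalityI subsetI UN_I)
    fix s :: complex
    show "s \<in> {s'. Re s' > 1 - real (nat \<lceil>2 - Re s\<rceil>)}" by simp linarith
  qed auto
  ultimately have "h holomorphic_on UNIV" by simp
  moreover have "h s = (s - 1) * (\<Sum>n. powr_cell p s (real n + w))" if "Re s > 1" for s
    using H(2) that by (simp add: h_def)
  ultimately show ?thesis using that by blast
qed

section \<open>The Hurwitz zeta function for \<open>Re s > 0\<close>\<close>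

lemma hurwitz_continuation_exists:
  assumes w: "w > 0"
  obtains f where "hurwitz_continuation w f"
    "\<And>s. Re s > 0 \<Longrightarrow> f s = complex_of_real w powr (1 - s) / (s - 1) +
       s * (\<Sum>n. powr_cell (\<lambda>t. complex_of_real (1 - t)) (s + 1) (real n + w))"
proof -
  let ?p = "\<lambda>t. complex_of_real (1 - t)"
  have p: "continuous_on {0..1} ?p"
    by (intro continuous_intros)
  obtain h where h: "h holomorphic_on UNIV"
    "\<And>s. Re s > 1 \<Longrightarrow> h s = (s - 1) * (\<Sum>n. powr_cell ?p s (real n + w))"
    using powr_cell_series_continuation[OF w p] by blast
  \<comment> \<open>As \<open>h\<close> is entire, only the first summand is singular at 1. For
    \<open>Re s > 0\<close> the argument \<open>s + 1\<close> lies where the series for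
    \<open>h\<close> converges.\<close>
  define f where "f s = complex_of_real w powr (1 - s) / (s - 1) + h (s + 1)" for s
  have f_eq: "f s = complex_of_real w powr (1 - s) / (s - 1) +
       s * (\<Sum>n. powr_cell ?p (s + 1) (real n + w))" if "Re s > 0" for s
    using h(2)[of "s + 1"] that by (simp add: f_def)
  have "(h \<circ> (\<lambda>s. s + 1)) holomorphic_on (- {1})"
    by (rule holomorphic_on_compose_gen[OF _ h(1)]) (auto intro!: holomorphic_intros)
  then have "f holomorphic_on (- {1})"
    unfolding f_def o_def by (intro holomorphic_intros) (use w in auto)
  moreover have "(\<lambda>n. complex_of_real (real n + w) powr (- s)) sums f s" if s: "Re s > 1" for s
  proof -
    have "(\<lambda>n. powr_cell (\<lambda>_. 1) s (real n + w) + s * powr_cell ?p (s + 1) (real n + w)) sums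
        (complex_of_real w powr (1 - s) / (s - 1) +
         s * (\<Sum>n. powr_cell ?p (s + 1) (real n + w)))"
      using s by (intro sums_add sums_mult sums_powr_cell_one sums_powr_cell w p) auto
    moreover have "complex_of_real (real n + w) powr (- s) =
        powr_cell (\<lambda>_. 1) s (real n + w) + s * powr_cell ?p (s + 1) (real n + w)" for n
      using w by (intro powr_eq_powr_cell) auto
    ultimately show ?thesis
      using f_eq[of s] s by simp
  qed
  ultimately have "hurwitz_continuation w f"
    unfolding hurwitz_continuation_def by blast
  then show ?thesis
    using f_eq by (rule that)
qed

text \<open>By uniqueness off 1, the continuation picked by \<open>SOME\<close> agrees with the one
  constructed.\<close>

lemma hurwitz_zeta_eq:
  assumes "w > 0" "Re s > 0" "s \<noteq> 1"
  shows "hurwitz_zeta s w = complex_of_real w powr (1 - s) / (s - 1) +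
       s * (\<Sum>n. powr_cell (\<lambda>t. complex_of_real (1 - t)) (s + 1) (real n + w))"
proof -
  obtain f where f: "hurwitz_continuation w f"
    "\<And>s. Re s > 0 \<Longrightarrow> f s = complex_of_real w powr (1 - s) / (s - 1) +
       s * (\<Sum>n. powr_cell (\<lambda>t. complex_of_real (1 - t)) (s + 1) (real n + w))"
    using hurwitz_continuation_exists[OF assms(1)] by blast
  have "hurwitz_continuation w (SOME f. hurwitz_continuation w f)"
    by (rule someI[of "hurwitz_continuation w", OF f(1)])
  from hurwitz_continuation_unique[OF this f(1) assms(3)] f(2)[OF assms(2)] show ?thesis
    by (simp add: hurwitz_zeta_def)
qed

section \<open>The inequality on the real axis\<close>

lemma powr_cell_of_real:
  assumes "x > 0" "continuous_on {0..1} q"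
  shows "powr_cell (\<lambda>t. complex_of_real (q t)) (complex_of_real r) x =
         complex_of_real (integral {0..1} (\<lambda>t. q t * (x + t) powr (- r)))"
proof -
  have "(\<lambda>t. q t * (x + t) powr (- r)) integrable_on {0..1}"
    using assms by (intro integrable_continuous_real continuous_intros) auto
  then have "((\<lambda>t. complex_of_real (q t * (x + t) powr (- r))) has_integral
      complex_of_real (integral {0..1} (\<lambda>t. q t * (x + t) powr (- r)))) {0..1}"
    by (intro has_integral_of_real integrable_integral)
  then have "integral {0..1} (\<lambda>t. complex_of_real (q t * (x + t) powr (- r))) =
      complex_of_real (integral {0..1} (\<lambda>t. q t * (x + t) powr (- r)))"
    by (rule integral_unique)
  moreover have "powr_cell (\<lambda>t. complex_of_real (q t)) (complex_of_real r) x =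
      integral {0..1} (\<lambda>t. complex_of_real (q t * (x + t) powr (- r)))"
    unfolding powr_cell_def using assms
    by (intro integral_cong) (auto simp flip: powr_of_real of_real_minus of_real_add)
  ultimately show ?thesis by simp
qed

theorem mainTheorem1:
  fixes w \<sigma> :: real
  assumes "w > 0" and "\<sigma> > 0" and "\<sigma> \<noteq> 1"
  shows "hurwitz_zeta (complex_of_real \<sigma>) w \<in> \<real> \<and>
         Re (hurwitz_zeta (complex_of_real \<sigma>) w) < (1 - \<sigma> - w) / ((1 - \<sigma>) * w powr \<sigma>)"
proof -
  \<comment> \<open>The cells at exponent \<open>\<sigma> + 1 > 1\<close> as real numbers. Their
    series converge for every \<open>\<sigma> > 0\<close>, even where the Dirichlet series
    diverges.\<close>
  define I where "I q n = integral {0..1} (\<lambda>t. q t * (real n + w + t) powr (- (\<sigma> + 1)))"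
    for q :: "real \<Rightarrow> real" and n
  have cell: "powr_cell (\<lambda>t. complex_of_real (q t)) (complex_of_real \<sigma> + 1) (real n + w) =
      complex_of_real (I q n)" if "continuous_on {0..1} q" for q n
    using powr_cell_of_real[OF _ that, of "real n + w" "\<sigma> + 1"] assms by (simp add: I_def)
  have summable: "summable (I q)" if q: "continuous_on {0..1} q" for q
  proof -
    have "continuous_on {0..1} (\<lambda>t. complex_of_real (q t))"
      using q by (intro continuous_intros)
    from sums_powr_cell[OF assms(1) this, of "complex_of_real \<sigma> + 1"] cell[OF q] assms
    have "summable (\<lambda>n. complex_of_real (I q n))"
      by (simp add: sums_iff)
    then show ?thesis by simp
  qed
  have suminf_cell: "(\<Sum>n. powr_cell (\<lambda>t. complex_of_real (q t)) (complex_of_real \<sigma> + 1) (real n + w)) =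
      complex_of_real (suminf (I q))" if "continuous_on {0..1} q" for q
    using cell[OF that] suminf_of_real[OF summable[OF that], where 'a = complex] by simp

  \<comment> \<open>The telescoped value at \<open>s = \<sigma> + 1\<close>, where
    \<open>1 - s = - \<sigma>\<close> and \<open>s - 1 = \<sigma>\<close>.\<close>
  have "complex_of_real (suminf (I (\<lambda>_. 1))) = complex_of_real (w powr (- \<sigma>) / \<sigma>)"
    using suminf_cell[of "\<lambda>_. 1"] assms
      sums_unique[OF sums_powr_cell_one[OF assms(1), of "complex_of_real \<sigma> + 1"]]
    by (simp flip: powr_of_real of_real_minus)
  then have one: "suminf (I (\<lambda>_. 1)) = w powr (- \<sigma>) / \<sigma>"
    by (simp only: of_real_eq_iff)

  \<comment> \<open>The weights differ by \<open>t\<close>, which is positive inside the unit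
    interval.\<close>
  have less: "I (\<lambda>t. 1 - t) n < I (\<lambda>_. 1) n" for n
    unfolding I_def
    by (rule integral_less_real) (use assms in \<open>auto intro!: continuous_intros\<close>)
  \<comment> \<open>Strictness survives summation because a convergent series of positive
    differences has a positive sum.\<close>
  have "suminf (I (\<lambda>t. 1 - t)) < suminf (I (\<lambda>_. 1))"
  proof -
    have s: "summable (I (\<lambda>t. 1 - t))" "summable (I (\<lambda>_. 1))"
      by (auto intro!: summable continuous_intros)
    then have "0 < (\<Sum>n. I (\<lambda>_. 1) n - I (\<lambda>t. 1 - t) n)"
      using less by (intro suminf_pos summable_diff) auto
    with suminf_diff[OF s(2,1)] show ?thesis by simp
  qed
  with one have "\<sigma> * suminf (I (\<lambda>t. 1 - t)) < w powr (- \<sigma>)"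
    using assms by (simp add: pos_less_divide_eq mult.commute)
  moreover have "hurwitz_zeta (complex_of_real \<sigma>) w =
      complex_of_real (w powr (1 - \<sigma>) / (\<sigma> - 1) + \<sigma> * suminf (I (\<lambda>t. 1 - t)))"
  proof -
    have "complex_of_real w powr (1 - complex_of_real \<sigma>) = complex_of_real (w powr (1 - \<sigma>))"
      using assms by (simp flip: powr_of_real)
    moreover have "continuous_on {0..1} (\<lambda>t::real. 1 - t)"
      by (intro continuous_intros)
    note suminf_cell[OF this]
    ultimately show ?thesis
      using hurwitz_zeta_eq[of w "complex_of_real \<sigma>"] assms by simp
  qed
  \<comment> \<open>The claimed bound is the formula for zeta with
    \<open>\<sigma> * suminf (I (\<lambda>t. 1 - t))\<close> replaced by its strict upper bound
    \<open>w powr (- \<sigma>)\<close>.\<close>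
  moreover have "w powr (1 - \<sigma>) / (\<sigma> - 1) + w powr (- \<sigma>) =
      (1 - \<sigma> - w) / ((1 - \<sigma>) * w powr \<sigma>)"
    using assms by (simp add: powr_diff powr_minus field_simps)
  ultimately show ?thesis by simp
qed

end
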